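(* Let $X$ be a set with at least two elements and let $\mathcal I$ be a total ideal of $\Pi(X)$. Given the cross-connection $\Gamma=j(\mathcal I,\Pi(X))$ (the inclusion functor) from $\mathcal I$ to $\mathscr P(X)$, the cross-connection semigroup $\tilde S\Gamma$ is isomorphic to a right reductive regular subsemigroup of $Sing(X)$.
   Context: All maps and morphisms are composed from left to right. $Sing(X)$ is the set of all non-invertible transformations of $X$, with composition; a regular subsemigroup of $Sing(X)$ is a subset closed under composition that is a regular semigroup. $\pi_a$ is the kernel partition (non-empty fibres) of a transformation $a$. A semigroup $S$ is right reductive if its right-regular representation $a\mapsto\rho_a$, $\rho_a:x\mapsto xa$, is injective. Powerset category $\mathscr P(X)$: objects are the non-empty proper subsets of $X$; morphisms $A\to B$ are all functions. Category of partitions $\Pi(X)$: a partition is non-identity if at least one block has more than one element. For such $\pi$, $\bar\pi$ is the set of all functions from (the set of blocks) $\pi$ to $X$. Objects are the $\bar\pi$; morphisms $\bar\pi_1\to\bar\pi_2$ are the maps $\eta^\ast:\alpha\mapsto\eta\alpha$ for functions $\eta:\pi_2\to\pi_1$. Write $\bar\pi_1\subseteq\bar\pi_2$ ($\bar\pi_1$ is a subobject of $\bar\pi_2$) if every block of $\pi_2$ lies in a block of $\pi_1$. An ideal of $\Pi(X)$ is a full subcategory whose set of objects is closed under subobjects. A cross-section of a partition is a set containing exactly one element of each block. The ideal $\mathcal I$ is total if for every non-empty proper subset $A$ of $X$ there is an object $\bar\pi$ of $\mathcal I$ such that $A$ is a cross-section of $\pi$. The normal dual $N^\ast\mathscr P(X)$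 is identified with $\Pi(X)$ and $N^\ast\mathcal I$ with $\mathscr P(X)$; the dual cross-connection of $\Gamma$ is $\Delta=1_{\mathscr P(X)}$. The bifunctors $\Gamma(-,-),\Delta(-,-):\mathscr P(X)\times\mathcal I\to\mathbf{Set}$ are given by $\Gamma(A,\bar\pi)=\{a\in Sing(X):\mathrm{Im}\,a\subseteq A,\ \bar\pi_a\subseteq\Gamma(\bar\pi)=\bar\pi\}$ and $\Delta(A,\bar\pi)=\{a\in Sing(X):\mathrm{Im}\,a\subseteq\Delta(A)=A,\ \bar\pi_a\subseteq\bar\pi\}$; for $(f,v^\ast):(A,\bar\pi)\to(B,\bar\pi')$, both act by $a\mapsto vaf$, where a transformation constant on the blocks of a partition is regarded as a map from that partition to $X$, and conversely. The duality $\chi_\Gamma$ is the natural isomorphism $\Gamma(-,-)\to\Delta(-,-)$, which is given by $a\mapsto a$. Put $U\Gamma=\bigcup\Gamma(A,\bar\pi)$ (composition of transformations) and $U\Delta=\bigcup\Delta(A,\bar\pi)$ (opposite multiplication $b'\ast b=bb'$), unions over objects of $\mathscr P(X)\times\mathcal I$. An element $a\in U\Gamma$ is linked to $b\in U\Delta$ if there is $(A,\bar\pi)$ with $a\in\Gamma(A,\bar\pi)$ and $b=\chi_\Gamma(A,\bar\pi)(a)$. The cross-connection semigroup is $\tilde S\Gamma=\{(a,b)\in U\Gamma\times U\Delta: a\text{ is linked to }b\}$ with $(a,b)\circ(a',b')=(aa',\,b'\ast b)$. *)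

theory Defs
  imports "HOL-Library.FuncSet" "HOL-Library.Disjoint_Sets"
begin

text \<open>
  The set \<open>X\<close> of the mathematical text is the universe of the type \<open>'a\<close>. All maps and morphisms
  are composed from left to right: the product \<open>ab\<close> of transformations is the function \<open>b \<circ> a\<close>.
\<close>

section \<open>Semigroups\<close>

record 's semigroup_data =
  elems :: "'s set"
  mul :: "'s \<Rightarrow> 's \<Rightarrow> 's"

definition is_semigroup :: "'s semigroup_data \<Rightarrow> bool" where
  "is_semigroup S \<longleftrightarrow>
     (\<forall>a\<in>elems S. \<forall>b\<in>elems S. mul S a b \<in> elems S) \<and>
     (\<forall>a\<in>elems S. \<forall>b\<in>elems S. \<forall>c\<in>elems S. mul S (mul S a b) c = mul S a (mul S b c))"

definition regular_semigroup :: "'s semigroup_data \<Rightarrow> bool" where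
  "regular_semigroup S \<longleftrightarrow>
     is_semigroup S \<and> (\<forall>a\<in>elems S. \<exists>b\<in>elems S. mul S (mul S a b) a = a)"

definition right_translation :: "'s semigroup_data \<Rightarrow> 's \<Rightarrow> 's \<Rightarrow> 's" where
  "right_translation S a = (\<lambda>x\<in>elems S. mul S x a)"

definition right_reductive :: "'s semigroup_data \<Rightarrow> bool" where
  "right_reductive S \<longleftrightarrow> is_semigroup S \<and> inj_on (right_translation S) (elems S)"

definition semigroup_isomorphism ::
    "'s semigroup_data \<Rightarrow> 't semigroup_data \<Rightarrow> ('s \<Rightarrow> 't) \<Rightarrow> bool" where
  "semigroup_isomorphism S T h \<longleftrightarrow>
     is_semigroup S \<and> is_semigroup T \<and> bij_betw h (elems S) (elems T) \<and>
     (\<forall>a\<in>elems S. \<forall>b\<in>elems S. h (mul S a b) = mul T (h a) (h b))"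

definition isomorphic_semigroups :: "'s semigroup_data \<Rightarrow> 't semigroup_data \<Rightarrow> bool" where
  "isomorphic_semigroups S T \<longleftrightarrow> (\<exists>h. semigroup_isomorphism S T h)"

section \<open>Singular transformations\<close>

definition Sing :: "('a \<Rightarrow> 'a) set" where
  "Sing = {a. \<not> bij a}"

definition transf_semigroup :: "('a \<Rightarrow> 'a) set \<Rightarrow> ('a \<Rightarrow> 'a) semigroup_data" where
  "transf_semigroup T = \<lparr>elems = T, mul = (\<lambda>a b. b \<circ> a)\<rparr>"

definition regular_subsemigroup_of_Sing :: "('a \<Rightarrow> 'a) set \<Rightarrow> bool" where
  "regular_subsemigroup_of_Sing T \<longleftrightarrow>
     T \<subseteq> Sing \<and> (\<forall>a\<in>T. \<forall>b\<in>T. b \<circ> a \<in> T) \<and> regular_semigroup (transf_semigroup T)"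

definition kernel_partition :: "('a \<Rightarrow> 'a) \<Rightarrow> 'a set set" where
  "kernel_partition a = (\<lambda>y. a -` {y}) ` range a"

section \<open>Categories, functors, natural isomorphisms\<close>

text \<open>
  Hom-sets need not be disjoint, so composition and functors also take the objects as arguments:
  \<open>cmp C A B E f g\<close> is the composite of first \<open>f : A \<rightarrow> B\<close>, then \<open>g : B \<rightarrow> E\<close>.
\<close>

record ('o, 'm) category =
  obj :: "'o set"
  hom :: "'o \<Rightarrow> 'o \<Rightarrow> 'm set"
  idm :: "'o \<Rightarrow> 'm"
  cmp :: "'o \<Rightarrow> 'o \<Rightarrow> 'o \<Rightarrow> 'm \<Rightarrow> 'm \<Rightarrow> 'm"

definition is_category :: "('o, 'm) category \<Rightarrow> bool" where
  "is_category C \<longleftrightarrow>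
     (\<forall>A\<in>obj C. idm C A \<in> hom C A A) \<and>
     (\<forall>A\<in>obj C. \<forall>B\<in>obj C. \<forall>E\<in>obj C. \<forall>f\<in>hom C A B. \<forall>g\<in>hom C B E.
        cmp C A B E f g \<in> hom C A E) \<and>
     (\<forall>A\<in>obj C. \<forall>B\<in>obj C. \<forall>f\<in>hom C A B.
        cmp C A A B (idm C A) f = f \<and> cmp C A B B f (idm C B) = f) \<and>
     (\<forall>A\<in>obj C. \<forall>B\<in>obj C. \<forall>E\<in>obj C. \<forall>F\<in>obj C.
        \<forall>f\<in>hom C A B. \<forall>g\<in>hom C B E. \<forall>h\<in>hom C E F.
          cmp C A E F (cmp C A B E f g) h = cmp C A B F f (cmp C B E F g h))"

definition full_subcategory :: "('o, 'm) category \<Rightarrow> ('o, 'm) category \<Rightarrow> bool" where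
  "full_subcategory D C \<longleftrightarrow>
     obj D \<subseteq> obj C \<and>
     (\<forall>A\<in>obj D. idm D A = idm C A) \<and>
     (\<forall>A\<in>obj D. \<forall>B\<in>obj D. hom D A B = hom C A B) \<and>
     (\<forall>A\<in>obj D. \<forall>B\<in>obj D. \<forall>E\<in>obj D. \<forall>f\<in>hom C A B. \<forall>g\<in>hom C B E.
        cmp D A B E f g = cmp C A B E f g)"

definition product_category ::
    "('o, 'm) category \<Rightarrow> ('p, 'n) category \<Rightarrow> ('o \<times> 'p, 'm \<times> 'n) category" where
  "product_category C D =
     \<lparr>obj = obj C \<times> obj D,
      hom = (\<lambda>A B. hom C (fst A) (fst B) \<times> hom D (snd A) (snd B)),
      idm = (\<lambda>A. (idm C (fst A), idm D (snd A))),
      cmp = (\<lambda>A B E f g. (cmp C (fst A) (fst B) (fst E) (fst f) (fst g),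
                          cmp D (snd A) (snd B) (snd E) (snd f) (snd g)))\<rparr>"

record ('o, 'm, 'p, 'n) functor_data =
  onobj :: "'o \<Rightarrow> 'p"
  onmor :: "'o \<Rightarrow> 'o \<Rightarrow> 'm \<Rightarrow> 'n"

definition is_functor ::
    "('o, 'm) category \<Rightarrow> ('p, 'n) category \<Rightarrow> ('o, 'm, 'p, 'n) functor_data \<Rightarrow> bool" where
  "is_functor C D F \<longleftrightarrow>
     (\<forall>A\<in>obj C. onobj F A \<in> obj D) \<and>
     (\<forall>A\<in>obj C. \<forall>B\<in>obj C. \<forall>f\<in>hom C A B. onmor F A B f \<in> hom D (onobj F A) (onobj F B)) \<and>
     (\<forall>A\<in>obj C. onmor F A A (idm C A) = idm D (onobj F A)) \<and>
     (\<forall>A\<in>obj C. \<forall>B\<in>obj C. \<forall>E\<in>obj C. \<forall>f\<in>hom C A B. \<forall>g\<in>hom C B E.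
        onmor F A E (cmp C A B E f g) =
        cmp D (onobj F A) (onobj F B) (onobj F E) (onmor F A B f) (onmor F B E g))"

definition inclusion_functor ::
    "('o, 'm) category \<Rightarrow> ('o, 'm) category \<Rightarrow> ('o, 'm, 'o, 'm) functor_data" where
  "inclusion_functor D C = \<lparr>onobj = (\<lambda>A. A), onmor = (\<lambda>A B f. f)\<rparr>"

definition identity_functor :: "('o, 'm) category \<Rightarrow> ('o, 'm, 'o, 'm) functor_data" where
  "identity_functor C = inclusion_functor C C"

definition natural_isomorphism ::
    "('o, 'm) category \<Rightarrow> ('p, 'n) category \<Rightarrow> ('o, 'm, 'p, 'n) functor_data \<Rightarrow>
     ('o, 'm, 'p, 'n) functor_data \<Rightarrow> ('o \<Rightarrow> 'n) \<Rightarrow> bool" where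
  "natural_isomorphism C D F G t \<longleftrightarrow>
     (\<forall>A\<in>obj C. t A \<in> hom D (onobj F A) (onobj G A) \<and>
        (\<exists>s\<in>hom D (onobj G A) (onobj F A).
           cmp D (onobj F A) (onobj G A) (onobj F A) (t A) s = idm D (onobj F A) \<and>
           cmp D (onobj G A) (onobj F A) (onobj G A) s (t A) = idm D (onobj G A))) \<and>
     (\<forall>A\<in>obj C. \<forall>B\<in>obj C. \<forall>f\<in>hom C A B.
        cmp D (onobj F A) (onobj F B) (onobj G B) (onmor F A B f) (t B) =
        cmp D (onobj F A) (onobj G A) (onobj G B) (t A) (onmor G A B f))"

definition set_category :: "('b set, 'b \<Rightarrow> 'b) category" where
  "set_category =
     \<lparr>obj = UNIV,
      hom = (\<lambda>A B. A \<rightarrow>\<^sub>E B),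
      idm = (\<lambda>A. \<lambda>x\<in>A. x),
      cmp = (\<lambda>A B E f g. compose A g f)\<rparr>"

section \<open>The powerset category and the category of partitions\<close>

definition powerset_category :: "('a set, 'a \<Rightarrow> 'a) category" where
  "powerset_category =
     \<lparr>obj = {A. A \<noteq> {} \<and> A \<noteq> UNIV},
      hom = (\<lambda>A B. A \<rightarrow>\<^sub>E B),
      idm = (\<lambda>A. \<lambda>x\<in>A. x),
      cmp = (\<lambda>A B E f g. compose A g f)\<rparr>"

definition nonidentity_partition :: "'a set set \<Rightarrow> bool" where
  "nonidentity_partition \<pi> \<longleftrightarrow>
     partition_on UNIV \<pi> \<and> (\<exists>K\<in>\<pi>. \<exists>x\<in>K. \<exists>y\<in>K. x \<noteq> y)"

type_synonym 'a barset = "('a set \<Rightarrow> 'a) set"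
type_synonym 'a barmap = "('a set \<Rightarrow> 'a) \<Rightarrow> ('a set \<Rightarrow> 'a)"

definition bar :: "'a set set \<Rightarrow> 'a barset" where
  "bar \<pi> = \<pi> \<rightarrow>\<^sub>E UNIV"

text \<open>
  The partition underlying an object; it is unique as soon as \<open>'a\<close> has two elements, see
  \<open>bar_inject\<close> and \<open>blocks_bar\<close> below.
\<close>

definition blocks :: "'a barset \<Rightarrow> 'a set set" where
  "blocks P = (THE \<pi>. bar \<pi> = P)"

definition star :: "'a set set \<Rightarrow> 'a set set \<Rightarrow> ('a set \<Rightarrow> 'a set) \<Rightarrow> 'a barmap" where
  "star \<pi>1 \<pi>2 \<eta> = (\<lambda>\<alpha>\<in>bar \<pi>1. compose \<pi>2 \<alpha> \<eta>)"

definition partition_category :: "('a barset, 'a barmap) category" where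
  "partition_category =
     \<lparr>obj = {bar \<pi> | \<pi>. nonidentity_partition \<pi>},
      hom = (\<lambda>P Q. {star (blocks P) (blocks Q) \<eta> | \<eta>. \<eta> \<in> blocks Q \<rightarrow>\<^sub>E blocks P}),
      idm = (\<lambda>P. \<lambda>\<alpha>\<in>P. \<alpha>),
      cmp = (\<lambda>P Q R u v. compose P v u)\<rparr>"

definition subobject :: "'a barset \<Rightarrow> 'a barset \<Rightarrow> bool" where
  "subobject P Q \<longleftrightarrow>
     P \<in> obj partition_category \<and> Q \<in> obj partition_category \<and>
     refines UNIV (blocks Q) (blocks P)"

definition is_ideal :: "('a barset, 'a barmap) category \<Rightarrow> bool" where
  "is_ideal I \<longleftrightarrow>
     full_subcategory I partition_category \<and>
     (\<forall>P\<in>obj I. \<forall>Q\<in>obj partition_category. subobject Q P \<longrightarrow> Q \<in> obj I)"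

definition cross_section :: "'a set \<Rightarrow> 'a set set \<Rightarrow> bool" where
  "cross_section A \<pi> \<longleftrightarrow> A \<subseteq> \<Union>\<pi> \<and> (\<forall>K\<in>\<pi>. \<exists>!x. x \<in> A \<and> x \<in> K)"

definition is_total_ideal :: "('a barset, 'a barmap) category \<Rightarrow> bool" where
  "is_total_ideal I \<longleftrightarrow>
     is_ideal I \<and>
     (\<forall>A. A \<noteq> {} \<and> A \<noteq> UNIV \<longrightarrow> (\<exists>P\<in>obj I. cross_section A (blocks P)))"

section \<open>The bifunctors of a cross-connection and its duality\<close>

text \<open>
  With \<open>N\<^sup>*\<P>(X) = \<Pi>(X)\<close> and \<open>N\<^sup>*\<I> = \<P>(X)\<close>, a cross-connection from \<open>\<I>\<close> to \<open>\<P>(X)\<close> is in particular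
  a functor \<open>G\<close> from \<open>\<I>\<close> to \<open>\<Pi>(X)\<close>, and its dual one a functor \<open>D\<close> from \<open>\<P>(X)\<close> to \<open>\<P>(X)\<close>.
\<close>

type_synonym 'a bifunctor =
  "('a set \<times> 'a barset, ('a \<Rightarrow> 'a) \<times> 'a barmap, ('a \<Rightarrow> 'a) set, ('a \<Rightarrow> 'a) \<Rightarrow> ('a \<Rightarrow> 'a)) functor_data"

definition as_map_on :: "'a set set \<Rightarrow> ('a \<Rightarrow> 'a) \<Rightarrow> ('a set \<Rightarrow> 'a)" where
  "as_map_on \<pi> a = (\<lambda>K\<in>\<pi>. the_elem (a ` K))"

definition as_transf :: "'a set set \<Rightarrow> ('a set \<Rightarrow> 'a) \<Rightarrow> ('a \<Rightarrow> 'a)" where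
  "as_transf \<pi> \<alpha> = (\<lambda>x. \<alpha> (THE K. K \<in> \<pi> \<and> x \<in> K))"

text \<open>
  The transformation \<open>vaf\<close>, for \<open>f\<close> defined on the image of \<open>a\<close> and \<open>m = v\<^sup>*\<close> a morphism from
  \<open>P\<close> to \<open>Q\<close>: by definition of \<open>v\<^sup>*\<close>, the map \<open>va\<close> from the partition of \<open>Q\<close> to \<open>X\<close> is \<open>v\<^sup>*(a)\<close>.
\<close>

definition sandwich ::
    "'a barset \<Rightarrow> 'a barset \<Rightarrow> 'a barmap \<Rightarrow> ('a \<Rightarrow> 'a) \<Rightarrow> ('a \<Rightarrow> 'a) \<Rightarrow> ('a \<Rightarrow> 'a)" where
  "sandwich P Q m f a = f \<circ> as_transf (blocks Q) (m (as_map_on (blocks P) a))"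

definition Gamma_set ::
    "('a barset, 'a barmap, 'a barset, 'a barmap) functor_data \<Rightarrow>
     'a set \<Rightarrow> 'a barset \<Rightarrow> ('a \<Rightarrow> 'a) set" where
  "Gamma_set G A P =
     {a \<in> Sing. range a \<subseteq> A \<and> subobject (bar (kernel_partition a)) (onobj G P)}"

definition Delta_set ::
    "('a set, 'a \<Rightarrow> 'a, 'a set, 'a \<Rightarrow> 'a) functor_data \<Rightarrow>
     'a set \<Rightarrow> 'a barset \<Rightarrow> ('a \<Rightarrow> 'a) set" where
  "Delta_set D A P =
     {a \<in> Sing. range a \<subseteq> onobj D A \<and> subobject (bar (kernel_partition a)) P}"

definition Gamma_bifunctor ::
    "('a barset, 'a barmap, 'a barset, 'a barmap) functor_data \<Rightarrow> 'a bifunctor" where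
  "Gamma_bifunctor G =
     \<lparr>onobj = (\<lambda>(A, P). Gamma_set G A P),
      onmor = (\<lambda>(A, P) (B, Q) (f, m). \<lambda>a\<in>Gamma_set G A P.
        sandwich (onobj G P) (onobj G Q) (onmor G P Q m) f a)\<rparr>"

definition Delta_bifunctor ::
    "('a set, 'a \<Rightarrow> 'a, 'a set, 'a \<Rightarrow> 'a) functor_data \<Rightarrow> 'a bifunctor" where
  "Delta_bifunctor D =
     \<lparr>onobj = (\<lambda>(A, P). Delta_set D A P),
      onmor = (\<lambda>(A, P) (B, Q) (f, m). \<lambda>a\<in>Delta_set D A P.
        sandwich P Q m (onmor D A B f) a)\<rparr>"

definition dual_connection :: "('a set, 'a \<Rightarrow> 'a, 'a set, 'a \<Rightarrow> 'a) functor_data" where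
  "dual_connection = identity_functor powerset_category"

definition duality ::
    "('a barset, 'a barmap, 'a barset, 'a barmap) functor_data \<Rightarrow>
     'a set \<times> 'a barset \<Rightarrow> ('a \<Rightarrow> 'a) \<Rightarrow> ('a \<Rightarrow> 'a)" where
  "duality G = (\<lambda>(A, P). \<lambda>a\<in>Gamma_set G A P. a)"

section \<open>The cross-connection semigroup\<close>

definition U_Gamma ::
    "('a barset, 'a barmap) category \<Rightarrow>
     ('a barset, 'a barmap, 'a barset, 'a barmap) functor_data \<Rightarrow> ('a \<Rightarrow> 'a) semigroup_data" where
  "U_Gamma I G =
     \<lparr>elems = (\<Union>Z\<in>obj (product_category powerset_category I). onobj (Gamma_bifunctor G) Z),
      mul = (\<lambda>a b. b \<circ> a)\<rparr>"

definition U_Delta ::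
    "('a barset, 'a barmap) category \<Rightarrow>
     ('a set, 'a \<Rightarrow> 'a, 'a set, 'a \<Rightarrow> 'a) functor_data \<Rightarrow> ('a \<Rightarrow> 'a) semigroup_data" where
  "U_Delta I D =
     \<lparr>elems = (\<Union>Z\<in>obj (product_category powerset_category I). onobj (Delta_bifunctor D) Z),
      mul = (\<lambda>a b. a \<circ> b)\<rparr>"

definition linked ::
    "('a barset, 'a barmap) category \<Rightarrow>
     ('a barset, 'a barmap, 'a barset, 'a barmap) functor_data \<Rightarrow>
     ('a \<Rightarrow> 'a) \<Rightarrow> ('a \<Rightarrow> 'a) \<Rightarrow> bool" where
  "linked I G a b \<longleftrightarrow>
     (\<exists>Z\<in>obj (product_category powerset_category I).
        a \<in> onobj (Gamma_bifunctor G) Z \<and> b = duality G Z a)"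

definition cross_connection_semigroup ::
    "('a barset, 'a barmap) category \<Rightarrow>
     ('a barset, 'a barmap, 'a barset, 'a barmap) functor_data \<Rightarrow>
     (('a \<Rightarrow> 'a) \<times> ('a \<Rightarrow> 'a)) semigroup_data" where
  "cross_connection_semigroup I G =
     \<lparr>elems = {(a, b). a \<in> elems (U_Gamma I G) \<and> b \<in> elems (U_Delta I dual_connection) \<and>
                       linked I G a b},
      mul = (\<lambda>(a, b) (a', b').
        (mul (U_Gamma I G) a a', mul (U_Delta I dual_connection) b' b))\<rparr>"

section \<open>Well-definedness\<close>

lemma bar_subset:
  assumes "x \<noteq> (y::'a)" and "bar \<pi> \<subseteq> (bar \<sigma> :: 'a barset)"
  shows "\<pi> \<subseteq> \<sigma>"
proof
  fix K assume K: "K \<in> \<pi>"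
  obtain z :: 'a where z: "z \<noteq> undefined" using assms(1) by metis
  have "(\<lambda>L\<in>\<pi>. z) \<in> bar \<pi>" by (simp add: bar_def)
  then have m: "(\<lambda>L\<in>\<pi>. z) \<in> \<sigma> \<rightarrow>\<^sub>E (UNIV :: 'a set)"
    using assms(2) unfolding bar_def by blast
  show "K \<in> \<sigma>"
  proof (rule ccontr)
    assume "K \<notin> \<sigma>"
    then have "(\<lambda>L\<in>\<pi>. z) K = undefined" using m by (rule PiE_arb[rotated])
    then show False using K z by simp
  qed
qed

lemma bar_inject:
  assumes "x \<noteq> (y::'a)" shows "bar \<pi> = (bar \<sigma> :: 'a barset) \<longleftrightarrow> \<pi> = \<sigma>"
  using bar_subset[OF assms] by blast

lemma blocks_bar:
  assumes "x \<noteq> (y::'a)" shows "blocks (bar \<pi>) = (\<pi> :: 'a set set)"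
  unfolding blocks_def bar_inject[OF assms] by simp

lemma category_set: "is_category set_category"
  unfolding is_category_def set_category_def
  by (auto simp: compose_def PiE_iff extensional_def fun_eq_iff restrict_def)

lemma category_powerset: "is_category powerset_category"
  unfolding is_category_def powerset_category_def
  by (auto simp: compose_def PiE_iff extensional_def fun_eq_iff restrict_def)

lemma star_mem: "\<eta> \<in> \<sigma> \<rightarrow>\<^sub>E \<pi> \<Longrightarrow> star \<pi> \<sigma> \<eta> \<in> bar \<pi> \<rightarrow>\<^sub>E bar \<sigma>"
  by (auto simp: star_def bar_def compose_def)

lemma star_comp:
  assumes "\<eta> \<in> \<sigma> \<rightarrow>\<^sub>E \<pi>" "\<theta> \<in> \<tau> \<rightarrow>\<^sub>E \<sigma>"
  shows "compose (bar \<pi>) (star \<sigma> \<tau> \<theta>) (star \<pi> \<sigma> \<eta>) = star \<pi> \<tau> (compose \<tau> \<eta> \<theta>)"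
proof
  fix \<alpha>
  show "compose (bar \<pi>) (star \<sigma> \<tau> \<theta>) (star \<pi> \<sigma> \<eta>) \<alpha> = star \<pi> \<tau> (compose \<tau> \<eta> \<theta>) \<alpha>"
    using assms by (auto simp: compose_def star_def bar_def fun_eq_iff PiE_iff)
qed

lemma star_id: "star \<pi> \<pi> (\<lambda>K\<in>\<pi>. K) = (\<lambda>\<alpha>\<in>bar \<pi>. \<alpha>)"
  by (auto simp: star_def compose_def bar_def fun_eq_iff PiE_iff extensional_def)

lemma category_partition:
  assumes "x \<noteq> (y::'a)"
  shows "is_category (partition_category :: ('a barset, 'a barmap) category)"
proof -
  note bb = blocks_bar[OF assms]
  let ?C = "partition_category :: ('a barset, 'a barmap) category"
  have mem: "m \<in> P \<rightarrow>\<^sub>E Q" if h: "P \<in> obj ?C" "Q \<in> obj ?C" "m \<in> hom ?C P Q" for P Q m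
  proof -
    obtain \<pi> \<sigma> where e: "P = bar \<pi>" "Q = bar \<sigma>"
      using h by (auto simp: partition_category_def)
    then obtain \<eta> where "m = star \<pi> \<sigma> \<eta>" "\<eta> \<in> \<sigma> \<rightarrow>\<^sub>E \<pi>"
      using h(3) by (auto simp: partition_category_def bb)
    then show ?thesis unfolding e using star_mem by blast
  qed
  have c: "cmp ?C P Q R m n \<in> hom ?C P R"
    if k: "P \<in> obj ?C" "Q \<in> obj ?C" "R \<in> obj ?C" "m \<in> hom ?C P Q" "n \<in> hom ?C Q R" for P Q R m n
  proof -
    obtain \<pi> \<sigma> \<tau> where e: "P = bar \<pi>" "Q = bar \<sigma>" "R = bar \<tau>"
      using k by (auto simp: partition_category_def)
    obtain \<eta> \<theta> where h: "m = star \<pi> \<sigma> \<eta>" "\<eta> \<in> \<sigma> \<rightarrow>\<^sub>E \<pi>" "n = star \<sigma> \<tau> \<theta>" "\<theta> \<in> \<tau> \<rightarrow>\<^sub>E \<sigma>"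
      using k by (auto simp: partition_category_def bb e)
    have "compose \<tau> \<eta> \<theta> \<in> \<tau> \<rightarrow>\<^sub>E \<pi>" using h(2,4) by (auto simp: compose_def PiE_iff)
    then show ?thesis using star_comp[OF h(2,4)]
      by (auto simp: partition_category_def bb e h)
  qed
  have i: "idm ?C P \<in> hom ?C P P" if h: "P \<in> obj ?C" for P
  proof -
    obtain \<pi> where e: "P = bar \<pi>" using h by (auto simp: partition_category_def)
    have "(\<lambda>K\<in>\<pi>. K) \<in> \<pi> \<rightarrow>\<^sub>E \<pi>" by simp
    then have "\<exists>\<eta>. (\<lambda>\<alpha>\<in>bar \<pi>. \<alpha>) = star \<pi> \<pi> \<eta> \<and> \<eta> \<in> \<pi> \<rightarrow>\<^sub>E \<pi>"
      using star_id[of \<pi>] by metis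
    then show ?thesis by (simp add: e partition_category_def bb)
  qed
  have u: "cmp ?C P P Q (idm ?C P) m = m \<and> cmp ?C P Q Q m (idm ?C Q) = m"
    if "P \<in> obj ?C" "Q \<in> obj ?C" "m \<in> hom ?C P Q" for P Q m
    using mem[OF that] by (auto simp: partition_category_def compose_def fun_eq_iff PiE_iff extensional_def)
  have a: "cmp ?C P R S (cmp ?C P Q R m n) k = cmp ?C P Q S m (cmp ?C Q R S n k)"
    if "P \<in> obj ?C" "Q \<in> obj ?C" "m \<in> hom ?C P Q" for P Q R S m n k
    using mem[OF that] by (auto simp: partition_category_def compose_def fun_eq_iff PiE_iff)
  show ?thesis unfolding is_category_def using c i u a by blast
qed

lemma functor_inclusion:
  assumes "full_subcategory D C"
  shows "is_functor D C (inclusion_functor D C)"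
  using assms unfolding full_subcategory_def is_functor_def inclusion_functor_def by auto

lemma as_transf_eq:
  assumes "partition_on UNIV \<pi>" "K \<in> \<pi>" "x \<in> K"
  shows "as_transf \<pi> \<alpha> x = \<alpha> K"
proof -
  have "(THE K. K \<in> \<pi> \<and> x \<in> K) = K"
    using assms by (intro the_equality) (auto simp: partition_on_def disjoint_def)
  then show ?thesis by (simp add: as_transf_def)
qed

lemma kernel_partition_on: "partition_on UNIV (kernel_partition a)"
  unfolding partition_on_def disjoint_def kernel_partition_def by auto

lemma kernel_partition_mem: "K \<subseteq> a -` {a s} \<Longrightarrow> \<exists>L\<in>kernel_partition a. K \<subseteq> L"
  by (auto simp: kernel_partition_def)

lemma kernel_subobject:
  assumes "x \<noteq> (y::'a)" and p: "nonidentity_partition (\<pi> :: 'a set set)"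
  shows "subobject (bar (kernel_partition a)) (bar \<pi>) \<longleftrightarrow>
    (\<forall>K\<in>\<pi>. \<forall>s\<in>K. \<forall>t\<in>K. a s = a t)" (is "?L \<longleftrightarrow> ?R")
proof
  assume ?L
  then have l: "\<forall>K\<in>\<pi>. \<exists>L\<in>kernel_partition a. K \<subseteq> L"
    by (simp add: subobject_def refines_def blocks_bar[OF assms(1)])
  show ?R
  proof (intro ballI)
    fix K s t assume K: "K \<in> \<pi>" "s \<in> K" "t \<in> K"
    obtain L where L: "L \<in> kernel_partition a" "K \<subseteq> L" using l K by blast
    then have "s \<in> L" "t \<in> L" using K by auto
    then show "a s = a t" using L(1) by (auto simp: kernel_partition_def)
  qed
next
  assume r: ?R
  have po: "partition_on UNIV \<pi>" using p by (simp add: nonidentity_partition_def)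
  have s: "\<exists>L\<in>kernel_partition a. K \<subseteq> L" if K: "K \<in> \<pi>" for K
  proof -
    have "K \<noteq> {}" using po K by (auto simp: partition_on_def)
    then obtain s where "s \<in> K" by blast
    then have "K \<subseteq> a -` {a s}" using r K by blast
    then show ?thesis by (rule kernel_partition_mem)
  qed
  then have rf: "refines UNIV \<pi> (kernel_partition a)"
    by (simp add: refines_def po kernel_partition_on)
  obtain K u v where k: "K \<in> \<pi>" "u \<in> K" "v \<in> K" "u \<noteq> v"
    using p unfolding nonidentity_partition_def by blast
  obtain L where "L \<in> kernel_partition a" "K \<subseteq> L" using s[OF k(1)] by blast
  then have "nonidentity_partition (kernel_partition a)"
    unfolding nonidentity_partition_def using kernel_partition_on k by blast
  then show ?L using rf p
    unfolding subobject_def blocks_bar[OF assms(1)] partition_category_def by auto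
qed

lemma sandwich_eq:
  assumes "x \<noteq> (y::'a)" "nonidentity_partition (\<pi> :: 'a set set)" "nonidentity_partition \<sigma>"
    and "\<eta> \<in> \<sigma> \<rightarrow>\<^sub>E \<pi>" "\<forall>K\<in>\<pi>. \<forall>s\<in>K. \<forall>t\<in>K. a s = a t" "K \<in> \<sigma>" "s \<in> K" "t \<in> \<eta> K"
  shows "sandwich (bar \<pi>) (bar \<sigma>) (star \<pi> \<sigma> \<eta>) f a s = f (a t)"
proof -
  have eK: "\<eta> K \<in> \<pi>" using assms(4,6) by (rule PiE_mem)
  then have "a s = a t" if "s \<in> \<eta> K" for s using assms(5,8) that by blast
  then have "a ` \<eta> K = {a t}" using assms(8) by blast
  then have "as_map_on \<pi> a (\<eta> K) = a t" using eK by (simp add: as_map_on_def)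
  moreover have "as_map_on \<pi> a \<in> bar \<pi>" by (auto simp: as_map_on_def bar_def)
  moreover have "partition_on UNIV \<sigma>" using assms(3) by (simp add: nonidentity_partition_def)
  ultimately show ?thesis using assms(6,7)
    by (simp add: sandwich_def blocks_bar[OF assms(1)] as_transf_eq star_def compose_def)
qed

lemma not_surj_Sing: "range a \<subseteq> A \<Longrightarrow> A \<noteq> UNIV \<Longrightarrow> a \<in> Sing"
  by (auto simp: Sing_def bij_def)

lemma Gamma_set_Delta_set:
  "Gamma_set (inclusion_functor I partition_category) A P = Delta_set dual_connection A P"
  by (simp add: Gamma_set_def Delta_set_def inclusion_functor_def dual_connection_def
      identity_functor_def)

lemma Gamma_bifunctor_Delta_bifunctor:
  "Gamma_bifunctor (inclusion_functor I partition_category) = Delta_bifunctor dual_connection"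
  by (simp add: Gamma_bifunctor_def Delta_bifunctor_def Gamma_set_Delta_set)
    (simp add: inclusion_functor_def dual_connection_def identity_functor_def)

lemma Gamma_set_iff:
  assumes "x \<noteq> (y::'a)" "nonidentity_partition (\<pi> :: 'a set set)" "A \<noteq> UNIV"
  shows "a \<in> Gamma_set (inclusion_functor I partition_category) A (bar \<pi>) \<longleftrightarrow>
    range a \<subseteq> A \<and> (\<forall>K\<in>\<pi>. \<forall>s\<in>K. \<forall>t\<in>K. a s = a t)"
  unfolding Gamma_set_def inclusion_functor_def
  using not_surj_Sing[OF _ assms(3), of a] by (simp add: kernel_subobject[OF assms(1,2)]) blast


lemma partition_nonempty:
  assumes "nonidentity_partition \<pi>"
  shows "\<exists>K\<in>\<pi>. s \<in> K" and "K \<in> \<pi> \<Longrightarrow> K \<noteq> {}"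
  using assms unfolding nonidentity_partition_def partition_on_def by auto

lemma sandwich_mem:
  fixes x y :: 'a
  assumes xy: "x \<noteq> y" and p: "nonidentity_partition (\<pi> :: 'a set set)" "nonidentity_partition \<sigma>"
    and e: "\<eta> \<in> \<sigma> \<rightarrow>\<^sub>E \<pi>" and f: "f \<in> A \<rightarrow>\<^sub>E B" and AB: "A \<noteq> UNIV" "B \<noteq> UNIV"
    and a: "a \<in> Gamma_set (inclusion_functor I partition_category) A (bar \<pi>)"
  shows "sandwich (bar \<pi>) (bar \<sigma>) (star \<pi> \<sigma> \<eta>) f a
    \<in> Gamma_set (inclusion_functor I partition_category) B (bar \<sigma>)" (is "?b \<in> _")
proof -
  have r: "range a \<subseteq> A" and c: "\<forall>K\<in>\<pi>. \<forall>s\<in>K. \<forall>t\<in>K. a s = a t"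
    using a unfolding Gamma_set_iff[OF xy p(1) AB(1)] by blast+
  note eq = sandwich_eq[OF xy p e c]
  have "?b s \<in> B" for s
  proof -
    obtain K where K: "K \<in> \<sigma>" "s \<in> K" using partition_nonempty(1)[OF p(2)] by blast
    then have "\<eta> K \<in> \<pi>" using e by auto
    then obtain t where "t \<in> \<eta> K" using partition_nonempty(2)[OF p(1)] by blast
    then have "?b s = f (a t)" using eq[OF K] by blast
    moreover have "f (a t) \<in> B" using r f by (intro PiE_mem[OF f]) auto
    ultimately show ?thesis by simp
  qed
  moreover have "?b s = ?b s'" if K: "K \<in> \<sigma>" "s \<in> K" "s' \<in> K" for K s s'
  proof -
    have "\<eta> K \<in> \<pi>" using e K by auto
    then obtain t where "t \<in> \<eta> K" using partition_nonempty(2)[OF p(1)] by blast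
    then show ?thesis using eq[OF K(1,2)] eq[OF K(1,3)] by simp
  qed
  ultimately show ?thesis unfolding Gamma_set_iff[OF xy p(2) AB(2)] by blast
qed

lemma sandwich_id:
  fixes x y :: 'a
  assumes xy: "x \<noteq> y" and p: "nonidentity_partition (\<pi> :: 'a set set)" and A: "A \<noteq> UNIV"
    and a: "a \<in> Gamma_set (inclusion_functor I partition_category) A (bar \<pi>)"
  shows "sandwich (bar \<pi>) (bar \<pi>) (\<lambda>\<alpha>\<in>bar \<pi>. \<alpha>) (\<lambda>x\<in>A. x) a = a"
proof
  fix s
  have r: "range a \<subseteq> A" and c: "\<forall>K\<in>\<pi>. \<forall>s\<in>K. \<forall>t\<in>K. a s = a t"
    using a unfolding Gamma_set_iff[OF xy p A] by blast+
  obtain K where K: "K \<in> \<pi>" "s \<in> K" using partition_nonempty(1)[OF p] by blast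
  have "(\<lambda>K\<in>\<pi>. K) \<in> \<pi> \<rightarrow>\<^sub>E \<pi>" by auto
  then have "sandwich (bar \<pi>) (bar \<pi>) (star \<pi> \<pi> (\<lambda>K\<in>\<pi>. K)) (\<lambda>x\<in>A. x) a s = (\<lambda>x\<in>A. x) (a s)"
    using sandwich_eq[OF xy p p _ c K, of "\<lambda>K\<in>\<pi>. K" s] K by simp
  moreover have "a s \<in> A" using r by auto
  ultimately show "sandwich (bar \<pi>) (bar \<pi>) (\<lambda>\<alpha>\<in>bar \<pi>. \<alpha>) (\<lambda>x\<in>A. x) a s = a s"
    by (simp add: star_id)
qed

lemma sandwich_comp:
  fixes x y :: 'a
  assumes xy: "x \<noteq> y" and p: "nonidentity_partition (\<pi> :: 'a set set)" "nonidentity_partition \<sigma>"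
      "nonidentity_partition \<tau>"
    and e: "\<eta> \<in> \<sigma> \<rightarrow>\<^sub>E \<pi>" "\<theta> \<in> \<tau> \<rightarrow>\<^sub>E \<sigma>" and f: "f \<in> A \<rightarrow>\<^sub>E B" and AB: "A \<noteq> UNIV" "B \<noteq> UNIV"
    and a: "a \<in> Gamma_set (inclusion_functor I partition_category) A (bar \<pi>)"
  shows "sandwich (bar \<pi>) (bar \<tau>) (compose (bar \<pi>) (star \<sigma> \<tau> \<theta>) (star \<pi> \<sigma> \<eta>)) (compose A g f) a =
    sandwich (bar \<sigma>) (bar \<tau>) (star \<sigma> \<tau> \<theta>) g (sandwich (bar \<pi>) (bar \<sigma>) (star \<pi> \<sigma> \<eta>) f a)"
proof
  fix s
  let ?b = "sandwich (bar \<pi>) (bar \<sigma>) (star \<pi> \<sigma> \<eta>) f a"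
  have r: "range a \<subseteq> A" and c: "\<forall>K\<in>\<pi>. \<forall>s\<in>K. \<forall>t\<in>K. a s = a t"
    using a unfolding Gamma_set_iff[OF xy p(1) AB(1)] by blast+
  have d: "\<forall>K\<in>\<sigma>. \<forall>s\<in>K. \<forall>t\<in>K. ?b s = ?b t"
    using sandwich_mem[OF xy p(1,2) e(1) f AB a] unfolding Gamma_set_iff[OF xy p(2) AB(2)]
    by (rule conjunct2)
  obtain K where K: "K \<in> \<tau>" "s \<in> K" using partition_nonempty(1)[OF p(3)] by blast
  have L: "\<theta> K \<in> \<sigma>" using e K by auto
  then obtain u where u: "u \<in> \<theta> K" using partition_nonempty(2)[OF p(2)] by blast
  have "\<eta> (\<theta> K) \<in> \<pi>" using e L by auto
  then obtain t where t: "t \<in> \<eta> (\<theta> K)" using partition_nonempty(2)[OF p(1)] by blast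
  have h: "compose \<tau> \<eta> \<theta> \<in> \<tau> \<rightarrow>\<^sub>E \<pi>" using e by (auto simp: compose_def)
  have t': "t \<in> compose \<tau> \<eta> \<theta> K" using t K by (simp add: compose_def)
  have "a t \<in> A" using r by auto
  then show "sandwich (bar \<pi>) (bar \<tau>) (compose (bar \<pi>) (star \<sigma> \<tau> \<theta>) (star \<pi> \<sigma> \<eta>)) (compose A g f) a s =
    sandwich (bar \<sigma>) (bar \<tau>) (star \<sigma> \<tau> \<theta>) g ?b s"
    unfolding star_comp[OF e]
      sandwich_eq[OF xy p(1,3) h c K t'] sandwich_eq[OF xy p(2,3) e(2) d K u]
      sandwich_eq[OF xy p(1,2) e(1) c L u t]
    by (simp add: compose_def)
qed

lemma functor_Gamma_bifunctor:
  fixes x y :: 'a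
  assumes xy: "x \<noteq> y" and I: "full_subcategory I (partition_category :: ('a barset, 'a barmap) category)"
  shows "is_functor (product_category powerset_category I) set_category
    (Gamma_bifunctor (inclusion_functor I partition_category))"
proof -
  let ?G = "inclusion_functor I partition_category"
  let ?F = "Gamma_bifunctor ?G"
  let ?C = "product_category powerset_category I"
  have Iobj: "obj I \<subseteq> obj partition_category"
    and Iid: "\<And>P. P \<in> obj I \<Longrightarrow> idm I P = idm partition_category P"
    and Ihom: "\<And>P Q. P \<in> obj I \<Longrightarrow> Q \<in> obj I \<Longrightarrow> hom I P Q = hom partition_category P Q"
    using I unfolding full_subcategory_def by blast+
  have ob: "\<exists>A \<pi>. Z = (A, bar \<pi>) \<and> A \<noteq> UNIV \<and> nonidentity_partition \<pi> \<and> bar \<pi> \<in> obj I"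
    if Z: "Z \<in> obj ?C" for Z
  proof -
    obtain A P where ZA: "Z = (A, P)" "A \<noteq> UNIV" "P \<in> obj I"
      using Z by (cases Z) (simp add: product_category_def powerset_category_def)
    then obtain \<pi> where "P = bar \<pi>" "nonidentity_partition \<pi>"
      using Iobj unfolding partition_category_def by auto
    then show ?thesis using ZA by blast
  qed
  have mor: "\<exists>f \<eta>. h = (f, star \<pi> \<sigma> \<eta>) \<and> f \<in> A \<rightarrow>\<^sub>E B \<and> \<eta> \<in> \<sigma> \<rightarrow>\<^sub>E \<pi>"
    if o: "bar \<pi> \<in> obj I" "bar \<sigma> \<in> obj I" and h: "h \<in> hom ?C (A, bar \<pi>) (B, bar \<sigma>)"
    for A B \<pi> \<sigma> h
  proof -
    obtain f m where fm: "h = (f, m)" "f \<in> A \<rightarrow>\<^sub>E B" "m \<in> hom partition_category (bar \<pi>) (bar \<sigma>)"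
      using h by (cases h) (simp add: product_category_def powerset_category_def Ihom[OF o])
    then obtain \<eta> where "m = star \<pi> \<sigma> \<eta>" "\<eta> \<in> \<sigma> \<rightarrow>\<^sub>E \<pi>"
      by (auto simp: partition_category_def blocks_bar[OF xy])
    then show ?thesis using fm by blast
  qed
  have 1: "onmor ?F Z W h \<in> hom set_category (onobj ?F Z) (onobj ?F W)"
    if ZW: "Z \<in> obj ?C" "W \<in> obj ?C" and h: "h \<in> hom ?C Z W" for Z W h
  proof -
    obtain A \<pi> where Z: "Z = (A, bar \<pi>)" "A \<noteq> UNIV" "nonidentity_partition \<pi>" "bar \<pi> \<in> obj I"
      using ob[OF ZW(1)] by blast
    obtain B \<sigma> where W: "W = (B, bar \<sigma>)" "B \<noteq> UNIV" "nonidentity_partition \<sigma>" "bar \<sigma> \<in> obj I"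
      using ob[OF ZW(2)] by blast
    obtain f \<eta> where f: "h = (f, star \<pi> \<sigma> \<eta>)" "f \<in> A \<rightarrow>\<^sub>E B" "\<eta> \<in> \<sigma> \<rightarrow>\<^sub>E \<pi>"
      using mor[OF Z(4) W(4) h[unfolded Z(1) W(1)]] by blast
    show ?thesis using sandwich_mem[OF xy Z(3) W(3) f(3,2) Z(2) W(2)]
      by (auto simp: Z(1) W(1) f(1) Gamma_bifunctor_def set_category_def inclusion_functor_def)
  qed
  have 2: "onmor ?F Z Z (idm ?C Z) = idm set_category (onobj ?F Z)" if z: "Z \<in> obj ?C" for Z
  proof -
    obtain A \<pi> where Z: "Z = (A, bar \<pi>)" "A \<noteq> UNIV" "nonidentity_partition \<pi>" "bar \<pi> \<in> obj I"
      using ob[OF z] by blast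
    have "idm ?C Z = (\<lambda>x\<in>A. x, \<lambda>\<alpha>\<in>bar \<pi>. \<alpha>)"
      by (simp add: Z(1) product_category_def powerset_category_def Iid[OF Z(4)])
        (simp add: partition_category_def)
    then show ?thesis using sandwich_id[OF xy Z(3,2)]
      by (auto simp: Z(1) Gamma_bifunctor_def set_category_def inclusion_functor_def
          intro!: restrict_ext)
  qed
  have 3: "onmor ?F Z V (cmp ?C Z W V h k) =
      cmp set_category (onobj ?F Z) (onobj ?F W) (onobj ?F V) (onmor ?F Z W h) (onmor ?F W V k)"
    if zw: "Z \<in> obj ?C" "W \<in> obj ?C" "V \<in> obj ?C" and h: "h \<in> hom ?C Z W" and k: "k \<in> hom ?C W V"
    for Z W V h k
  proof -
    obtain A \<pi> where Z: "Z = (A, bar \<pi>)" "A \<noteq> UNIV" "nonidentity_partition \<pi>" "bar \<pi> \<in> obj I"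
      using ob[OF zw(1)] by blast
    obtain B \<sigma> where W: "W = (B, bar \<sigma>)" "B \<noteq> UNIV" "nonidentity_partition \<sigma>" "bar \<sigma> \<in> obj I"
      using ob[OF zw(2)] by blast
    obtain E \<tau> where V: "V = (E, bar \<tau>)" "E \<noteq> UNIV" "nonidentity_partition \<tau>" "bar \<tau> \<in> obj I"
      using ob[OF zw(3)] by blast
    obtain f \<eta> where f: "h = (f, star \<pi> \<sigma> \<eta>)" "f \<in> A \<rightarrow>\<^sub>E B" "\<eta> \<in> \<sigma> \<rightarrow>\<^sub>E \<pi>"
      using mor[OF Z(4) W(4) h[unfolded Z(1) W(1)]] by blast
    obtain g \<theta> where g: "k = (g, star \<sigma> \<tau> \<theta>)" "g \<in> B \<rightarrow>\<^sub>E E" "\<theta> \<in> \<tau> \<rightarrow>\<^sub>E \<sigma>"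
      using mor[OF W(4) V(4) k[unfolded W(1) V(1)]] by blast
    have s: "star \<pi> \<sigma> \<eta> \<in> hom partition_category (bar \<pi>) (bar \<sigma>)"
      "star \<sigma> \<tau> \<theta> \<in> hom partition_category (bar \<sigma>) (bar \<tau>)"
      using f(3) g(3) by (auto simp: partition_category_def blocks_bar[OF xy])
    have "cmp I (bar \<pi>) (bar \<sigma>) (bar \<tau>) (star \<pi> \<sigma> \<eta>) (star \<sigma> \<tau> \<theta>) =
        cmp partition_category (bar \<pi>) (bar \<sigma>) (bar \<tau>) (star \<pi> \<sigma> \<eta>) (star \<sigma> \<tau> \<theta>)"
      using I s Z(4) W(4) V(4) unfolding full_subcategory_def by blast
    then have c: "cmp ?C Z W V h k = (compose A g f, compose (bar \<pi>) (star \<sigma> \<tau> \<theta>) (star \<pi> \<sigma> \<eta>))"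
      by (simp add: Z(1) W(1) V(1) f(1) g(1) product_category_def powerset_category_def)
        (simp add: partition_category_def)
    show ?thesis
      unfolding c
      using sandwich_comp[OF xy Z(3) W(3) V(3) f(3) g(3) f(2) Z(2) W(2), of _ I g]
        sandwich_mem[OF xy Z(3) W(3) f(3,2) Z(2) W(2), of _ I]
      by (simp add: Z(1) W(1) V(1) f(1) g(1) Gamma_bifunctor_def set_category_def
          inclusion_functor_def compose_def cong: restrict_cong)
  qed
  have 0: "onobj ?F Z \<in> obj set_category" for Z by (simp add: set_category_def)
  show ?thesis unfolding is_functor_def using 0 1 2 3 by blast
qed

lemma natural_isomorphism_duality:
  fixes x y :: 'a
  assumes "x \<noteq> y" and "full_subcategory I (partition_category :: ('a barset, 'a barmap) category)"
    and G: "G = inclusion_functor I partition_category"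
  shows "natural_isomorphism (product_category powerset_category I) set_category
    (Gamma_bifunctor G) (Delta_bifunctor dual_connection) (duality G)"
proof -
  let ?C = "product_category powerset_category I"
  let ?F = "Gamma_bifunctor G"
  have F: "is_functor ?C set_category ?F" using functor_Gamma_bifunctor[OF assms(1,2)] G by simp
  have D: "Delta_bifunctor dual_connection = ?F" by (simp add: G Gamma_bifunctor_Delta_bifunctor)
  have d: "duality G Z = idm set_category (onobj ?F Z)" for Z
    by (cases Z) (simp add: duality_def set_category_def Gamma_bifunctor_def)
  have i: "idm set_category S \<in> hom set_category S S" and
    ii: "cmp set_category S S S (idm set_category S) (idm set_category S) = idm set_category S"
    for S :: "('a \<Rightarrow> 'a) set"
    by (auto simp: set_category_def compose_def)
  have u: "cmp set_category S T T f (idm set_category T) = f"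
    "cmp set_category S S T (idm set_category S) f = f"
    if "f \<in> hom set_category S T" for S T :: "('a \<Rightarrow> 'a) set" and f
    using that by (auto simp: set_category_def compose_def fun_eq_iff PiE_iff extensional_def)
  have m: "onmor ?F A B f \<in> hom set_category (onobj ?F A) (onobj ?F B)"
    if "A \<in> obj ?C" "B \<in> obj ?C" "f \<in> hom ?C A B" for A B f
    using F that unfolding is_functor_def by blast
  show ?thesis unfolding natural_isomorphism_def D d
    using i ii u m by (metis (no_types, lifting))
qed

end

theory Submission
  imports Defs
begin

text \<open>
  Since \<open>\<chi>\<^sub>\<Gamma>\<close> is the identity on elements, linked pairs are diagonal and the cross-connection semigroup
  is \<open>U\<Gamma>\<close> itself: the transformations with proper image that are constant on the blocks of some
  partition of the ideal. For regularity, choose a partition of the ideal having \<open>Im a\<close> as a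
  cross-section; collapsing each block to its point of \<open>Im a\<close> and then choosing a preimage under \<open>a\<close>
  gives \<open>b\<close> in \<open>U\<Gamma>\<close> with \<open>aba = a\<close>. Right reductivity holds because \<open>U\<Gamma>\<close> contains all constants.
\<close>

text \<open>The set \<open>A\<close> of an object \<open>(A, P)\<close> can always be shrunk to
  \<open>range a\<close>, so all that remains of it is that the image is proper; non-invertibility
  then comes for free. This gives a description of the semigroup without categories.\<close>

lemma elems_U_Gamma_iff:
  fixes x y :: 'a
  assumes xy: "x \<noteq> y" and I: "full_subcategory I partition_category"
  shows "a \<in> elems (U_Gamma I (inclusion_functor I partition_category)) \<longleftrightarrow>
    range a \<noteq> (UNIV :: 'a set) \<and>
    (\<exists>\<pi>. nonidentity_partition \<pi> \<and> bar \<pi> \<in> obj I \<and> (\<forall>K\<in>\<pi>. \<forall>s\<in>K. \<forall>t\<in>K. a s = a t))"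
    (is "?L \<longleftrightarrow> ?R")
proof -
  let ?G = "inclusion_functor I partition_category"
  have Iobj: "\<exists>\<pi>. P = bar \<pi> \<and> nonidentity_partition \<pi>" if "P \<in> obj I" for P
    using I that unfolding full_subcategory_def partition_category_def by auto
  have L: "?L \<longleftrightarrow> (\<exists>A P. A \<noteq> {} \<and> A \<noteq> UNIV \<and> P \<in> obj I \<and> a \<in> Gamma_set ?G A P)"
    by (auto simp: U_Gamma_def product_category_def powerset_category_def Gamma_bifunctor_def)
  show ?thesis
  proof
    assume ?L
    then obtain A P where A: "A \<noteq> UNIV" "P \<in> obj I" "a \<in> Gamma_set ?G A P"
      unfolding L by blast
    obtain \<pi> where p: "P = bar \<pi>" "nonidentity_partition \<pi>" using Iobj[OF A(2)] by blast
    have "range a \<subseteq> A" "\<forall>K\<in>\<pi>. \<forall>s\<in>K. \<forall>t\<in>K. a s = a t"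
      using A(3) unfolding p(1) Gamma_set_iff[OF xy p(2) A(1)] by blast+
    then show ?R using A p by blast
  next
    assume ?R
    then obtain \<pi> where p: "range a \<noteq> UNIV" "nonidentity_partition \<pi>" "bar \<pi> \<in> obj I"
        "\<forall>K\<in>\<pi>. \<forall>s\<in>K. \<forall>t\<in>K. a s = a t"
      by blast
    have "a \<in> Gamma_set ?G (range a) (bar \<pi>)"
      unfolding Gamma_set_iff[OF xy p(2,1)] using p(4) by blast
    then show ?L unfolding L using p(1,3) by blast
  qed
qed

lemma total_ideal_cross_section:
  fixes x y :: 'a and I :: "('a barset, 'a barmap) category"
  assumes xy: "x \<noteq> y" and I: "is_total_ideal I" and A: "A \<noteq> {}" "A \<noteq> UNIV"
  obtains \<pi> where "nonidentity_partition \<pi>" "bar \<pi> \<in> obj I" "cross_section A \<pi>"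
proof -
  obtain P where P: "P \<in> obj I" "cross_section A (blocks P)"
    using I A unfolding is_total_ideal_def by blast
  obtain \<pi> where "P = bar \<pi>" "nonidentity_partition \<pi>"
    using I P(1)
    unfolding is_total_ideal_def is_ideal_def full_subcategory_def partition_category_def by auto
  then show ?thesis using that P by (simp add: blocks_bar[OF xy])
qed

text \<open>Each point goes to the only point of \<open>A\<close> in its block, and a point of
  \<open>A\<close> is the representative of its own block.\<close>

lemma cross_section_retraction:
  assumes p: "partition_on UNIV \<pi>" and A: "cross_section A \<pi>"
  obtains e where "\<And>s. e s \<in> A" "\<And>s. s \<in> A \<Longrightarrow> e s = s" "\<forall>K\<in>\<pi>. \<forall>s\<in>K. \<forall>t\<in>K. e s = e t"
proof -
  define c where "c K = (THE z. z \<in> A \<and> z \<in> K)" for K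
  have c: "c K \<in> A" "c K \<in> K" if "K \<in> \<pi>" for K
    using theI'[of "\<lambda>z. z \<in> A \<and> z \<in> K"] A that unfolding cross_section_def c_def by blast+
  have c_eq: "c K = s" if "K \<in> \<pi>" "s \<in> A" "s \<in> K" for K s
    using A c[OF that(1)] that unfolding cross_section_def by blast
  have e: "as_transf \<pi> c s = c K" if "K \<in> \<pi>" "s \<in> K" for K s
    using as_transf_eq[OF p that] .
  have ex: "\<exists>K\<in>\<pi>. s \<in> K" for s using p unfolding partition_on_def by blast
  show ?thesis
  proof (rule that)
    show "as_transf \<pi> c s \<in> A" for s using ex[of s] e c(1) by force
    show "as_transf \<pi> c s = s" if "s \<in> A" for s using ex[of s] e c_eq that by metis
    show "\<forall>K\<in>\<pi>. \<forall>s\<in>K. \<forall>t\<in>K. as_transf \<pi> c s = as_transf \<pi> c t" using e by simp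
  qed
qed

lemma range_right_inverse_not_UNIV:
  assumes "\<And>z. z \<in> range a \<Longrightarrow> a (g z) = z" and "s \<noteq> t" "a s = a t"
  shows "g ` range a \<noteq> UNIV"
proof
  assume U: "g ` range a = UNIV"
  obtain u v where u: "u \<in> range a" "s = g u" and v: "v \<in> range a" "t = g v"
    using U by (metis UNIV_I imageE)
  have "u = v" using assms(1)[OF u(1)] assms(1)[OF v(1)] assms(3) u(2) v(2) by simp
  then show False using assms(2) u(2) v(2) by simp
qed

text \<open>A constant map respects every partition, so one object of \<open>I\<close> suffices;
  totality applied to the proper subset \<open>{z}\<close> supplies it.\<close>

lemma const_mem_U_Gamma:
  fixes x y z :: 'a
  assumes xy: "x \<noteq> y" and I: "is_total_ideal I"
  shows "(\<lambda>_. z) \<in> elems (U_Gamma I (inclusion_functor I partition_category))"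
proof -
  have z: "{z} \<noteq> UNIV" using xy by (metis UNIV_I singletonD)
  then obtain \<pi> where "nonidentity_partition \<pi>" "bar \<pi> \<in> obj I"
    using total_ideal_cross_section[OF xy I] by blast
  moreover have "full_subcategory I partition_category"
    using I unfolding is_total_ideal_def is_ideal_def by blast
  ultimately show ?thesis using z by (auto simp: elems_U_Gamma_iff[OF xy])
qed

lemma U_Gamma_comp:
  fixes x y :: 'a
  assumes "x \<noteq> y" and "full_subcategory I (partition_category :: ('a barset, 'a barmap) category)"
    and "a \<in> elems (U_Gamma I (inclusion_functor I partition_category))"
    and "b \<in> elems (U_Gamma I (inclusion_functor I partition_category))"
  shows "b \<circ> a \<in> elems (U_Gamma I (inclusion_functor I partition_category))"
proof -
  note iff = elems_U_Gamma_iff[OF assms(1,2)]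
  \<comment> \<open>The blocks come from the factor \<open>a\<close>, applied first, and the proper
    image from \<open>b\<close>, applied last.\<close>
  obtain \<pi> where p: "nonidentity_partition \<pi>" "bar \<pi> \<in> obj I"
      "\<forall>K\<in>\<pi>. \<forall>s\<in>K. \<forall>t\<in>K. a s = a t"
    using assms(3) unfolding iff by blast
  have "(b \<circ> a) s = (b \<circ> a) t" if "K \<in> \<pi>" "s \<in> K" "t \<in> K" for K s t
    unfolding comp_apply using p(3) that by (intro arg_cong[of _ _ b]) blast
  moreover have "range (b \<circ> a) \<subseteq> range b" by auto
  then have "range (b \<circ> a) \<noteq> UNIV" using assms(4) unfolding iff by blast
  ultimately show ?thesis unfolding iff using p(1,2) by blast
qed

lemma U_Gamma_regular:
  fixes x y :: 'a
  assumes xy: "x \<noteq> y" and I: "is_total_ideal (I :: ('a barset, 'a barmap) category)"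
    and a: "a \<in> elems (U_Gamma I (inclusion_functor I partition_category))"
  shows "\<exists>b\<in>elems (U_Gamma I (inclusion_functor I partition_category)). a \<circ> (b \<circ> a) = a"
proof -
  have "full_subcategory I partition_category"
    using I unfolding is_total_ideal_def is_ideal_def by blast
  note iff = elems_U_Gamma_iff[OF xy this]
  have r: "range a \<noteq> UNIV" using a unfolding iff by blast
  \<comment> \<open>A partition respected by \<open>a\<close> serves here only to yield two points
    that \<open>a\<close> identifies; the blocks for \<open>b\<close> will come from the
    cross-sectioned \<open>\<pi>\<close>.\<close>
  obtain \<sigma> where "nonidentity_partition \<sigma>" "\<forall>K\<in>\<sigma>. \<forall>s\<in>K. \<forall>t\<in>K. a s = a t"
    using a unfolding iff by blast
  then obtain s t where st: "s \<noteq> t" "a s = a t"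
    unfolding nonidentity_partition_def by blast
  obtain \<pi> where p: "nonidentity_partition \<pi>" "bar \<pi> \<in> obj I" "cross_section (range a) \<pi>"
    using total_ideal_cross_section[OF xy I _ r] by blast
  have "partition_on UNIV \<pi>" using p(1) by (simp add: nonidentity_partition_def)
  then obtain e where e: "\<And>s. e s \<in> range a" "\<And>s. s \<in> range a \<Longrightarrow> e s = s"
      "\<forall>K\<in>\<pi>. \<forall>s\<in>K. \<forall>t\<in>K. e s = e t"
    using p(3) by (rule cross_section_retraction) (rule that)
  \<comment> \<open>Since \<open>e\<close> maps into \<open>range a\<close>, only the values of
    \<open>inv a\<close> there matter, and on \<open>range a\<close> it is a right inverse of
    \<open>a\<close>.\<close>
  define b where "b = inv a \<circ> e"
  have "range b \<subseteq> inv a ` range a"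
    unfolding b_def image_comp[symmetric] by (intro image_mono image_subsetI e(1))
  moreover have "inv a ` range a \<noteq> UNIV"
    by (rule range_right_inverse_not_UNIV[OF _ st]) (rule f_inv_into_f)
  ultimately have "range b \<noteq> UNIV" by blast
  moreover have "b s = b t" if "K \<in> \<pi>" "s \<in> K" "t \<in> K" for K s t
    unfolding b_def comp_apply using e(3) that by (intro arg_cong[of _ _ "inv a"]) blast
  ultimately have "b \<in> elems (U_Gamma I (inclusion_functor I partition_category))"
    unfolding iff using p(1,2) by blast
  moreover have "a \<circ> (b \<circ> a) = a" by (simp add: b_def fun_eq_iff e(2) f_inv_into_f)
  ultimately show ?thesis by blast
qed

text \<open>The constant map with value \<open>z\<close>, followed by \<open>a\<close>, is the
  constant map with value \<open>a z\<close>; so the right translation by \<open>a\<close>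
  determines \<open>a\<close> at every point.\<close>

lemma right_reductive_transf:
  assumes "\<And>z. (\<lambda>_. z) \<in> T" and "\<And>a b. a \<in> T \<Longrightarrow> b \<in> T \<Longrightarrow> b \<circ> a \<in> T"
  shows "right_reductive (transf_semigroup T)"
proof -
  have "a = b"
    if "right_translation (transf_semigroup T) a = right_translation (transf_semigroup T) b" for a b
  proof
    fix z
    show "a z = b z"
      using fun_cong[OF that, of "\<lambda>_. z"] assms(1)[of z]
      by (simp add: right_translation_def transf_semigroup_def fun_eq_iff)
  qed
  then show ?thesis
    using assms(2)
    by (auto simp: right_reductive_def is_semigroup_def transf_semigroup_def comp_assoc
        intro!: inj_onI)
qed

text \<open>\<open>duality\<close> is the identity restricted to a set that must contain
  \<open>a\<close> for linking, so its default value outside never enters.\<close>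

lemma elems_cross_connection_semigroup:
  "elems (cross_connection_semigroup I (inclusion_functor I partition_category)) =
    (\<lambda>a. (a, a)) ` elems (U_Gamma I (inclusion_functor I partition_category))"
proof -
  let ?G = "inclusion_functor I partition_category"
  have "elems (U_Delta I dual_connection) = elems (U_Gamma I ?G)"
    by (simp add: U_Gamma_def U_Delta_def Gamma_bifunctor_Delta_bifunctor)
  moreover have "linked I ?G a b \<longleftrightarrow> a \<in> elems (U_Gamma I ?G) \<and> b = a" for a b
    by (auto simp: linked_def duality_def U_Gamma_def Gamma_bifunctor_def)
  ultimately show ?thesis by (auto simp: cross_connection_semigroup_def)
qed

text \<open>The swapped arguments in the second component cancel the opposite multiplication of
  \<open>U_Delta\<close>.\<close>

lemma mul_cross_connection_semigroup:
  "mul (cross_connection_semigroup I G) (a, b) (a', b') = (a' \<circ> a, b' \<circ> b)"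
  by (simp add: cross_connection_semigroup_def U_Gamma_def U_Delta_def)

theorem theorem5p6:
  fixes I :: "('a barset, 'a barmap) category"
    and \<Gamma> :: "('a barset, 'a barmap, 'a barset, 'a barmap) functor_data"
  assumes "\<exists>x y :: 'a. x \<noteq> y"
    and "is_total_ideal I"
    and "\<Gamma> = inclusion_functor I partition_category"
  shows "\<exists>T :: ('a \<Rightarrow> 'a) set.
           regular_subsemigroup_of_Sing T \<and>
           right_reductive (transf_semigroup T) \<and>
           isomorphic_semigroups (cross_connection_semigroup I \<Gamma>) (transf_semigroup T)"
proof -
  obtain x y :: 'a where xy: "x \<noteq> y" using assms(1) by blast
  have I: "full_subcategory I partition_category"
    using assms(2) unfolding is_total_ideal_def is_ideal_def by blast
  define T where "T = elems (U_Gamma I \<Gamma>)"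
  have closed: "b \<circ> a \<in> T" if "a \<in> T" "b \<in> T" for a b
    using that unfolding T_def assms(3) by (rule U_Gamma_comp[OF xy I])
  have semi: "is_semigroup (transf_semigroup T)"
    using closed by (auto simp: is_semigroup_def transf_semigroup_def comp_assoc)
  have "T \<subseteq> Sing"
    unfolding T_def assms(3)
    by (auto simp: elems_U_Gamma_iff[OF xy I] intro: not_surj_Sing[OF order_refl])
  moreover have "\<forall>a\<in>T. \<exists>b\<in>T. a \<circ> (b \<circ> a) = a"
    using U_Gamma_regular[OF xy assms(2)] unfolding T_def assms(3) by blast
  ultimately have "regular_subsemigroup_of_Sing T"
    using closed semi
    by (simp add: regular_subsemigroup_of_Sing_def regular_semigroup_def transf_semigroup_def)
  moreover have "right_reductive (transf_semigroup T)"
    by (rule right_reductive_transf)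
      (auto simp: T_def assms(3) const_mem_U_Gamma[OF xy assms(2)] intro: U_Gamma_comp[OF xy I])
  \<comment> \<open>On diagonal pairs the projection \<open>fst\<close> inverts the embedding of
    \<open>a\<close> as \<open>(a, a)\<close>.\<close>
  moreover have "semigroup_isomorphism (cross_connection_semigroup I \<Gamma>) (transf_semigroup T) fst"
  proof -
    have E: "elems (cross_connection_semigroup I \<Gamma>) = (\<lambda>a. (a, a)) ` T"
      unfolding T_def assms(3) by (rule elems_cross_connection_semigroup)
    have "is_semigroup (cross_connection_semigroup I \<Gamma>)"
      using closed by (auto simp: is_semigroup_def E mul_cross_connection_semigroup comp_assoc)
    moreover have "bij_betw fst ((\<lambda>a. (a, a)) ` T) T"
      by (auto simp: bij_betw_def inj_on_def image_image)
    ultimately show ?thesis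
      using semi by (auto simp: semigroup_isomorphism_def E mul_cross_connection_semigroup)
        (auto simp: transf_semigroup_def)
  qed
  ultimately show ?thesis unfolding isomorphic_semigroups_def by blast
qed

end
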